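(* Let $G$ and $H$ be graphs. Then any cell of $\pi\mathrm{Hom}(G,H)$ is a generalized permutohedron, and any generalized permutohedron occurs as a cell of some $\pi\mathrm{Hom}(G,H)$. Moreover, a cell $\pi(\sigma)$ of $\pi\mathrm{Hom}(G,H)$, where $\sigma=\sigma_1\times\dots\times\sigma_g$ is a cell of $\mathrm{Hom}(G,H)$, is a product of simplices if and only if $\sigma_i\cap\sigma_j=\emptyset$ for all $i\ne j$.
   Context: Graphs are finite and undirected, $V(G)=[g]$, $V(H)=[h]$. For a finite set $B$, $\Delta_B=\mathrm{conv}\{e_i:i\in B\}$; subsets of $B$ are identified with faces of $\Delta_B$. $\mathrm{Hom}(G,H)$ is the polytopal complex of all cells $\times_{i\in V(G)}\sigma_i$ (all $\sigma_i\subset V(H)$ nonempty) of $\times_{i\in V(G)}\Delta_{V(H)}$ such that if $(i,j)\in E(G)$, then $(\sigma_i,\sigma_j)$ is a complete bipartite subgraph of $H$, i.e. every $(u,v)\in\sigma_i\times\sigma_j$ is an edge of $H$. With $\mu_i:\mathbb R^h\hookrightarrow\mathbb R^{gh}=(\mathbb R^h)^g$ the inclusion as $i$-th block, $\mathrm{Hom}(G,H)$ is realized in $\mathbb R^{gh}$ with cells $\frac1g(\mu_1(\sigma_1)\times\dots\times\mu_g(\sigma_g))$. The map $\pi=\pi_\Delta\pi_\Box:\mathbb R^{gh}\times\mathbb R^g\to\mathbb R^h$ is $(x_1,\dots,x_g,y)\mapsto x_1+\dots+x_g$ ($x_i\in\mathbb R^h$), applied to $\mathrm{Hom}(G,H)\times(\frac1g,\dots,\frac1g)$,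 and $\pi\mathrm{Hom}(G,H)=\{\pi(\sigma):\sigma\text{ a cell of }\mathrm{Hom}(G,H)\}$; thus $\pi(\sigma)=\frac1g(\sigma_1+\dots+\sigma_g)\subset\Delta_{V(H)}$ (Minkowski sum). More generally, for positive reals $\lambda_1,\dots,\lambda_g$ with $\lambda=\sum_i\lambda_i$, one may use the weights $(\frac{\lambda_1}{\lambda},\dots,\frac{\lambda_g}{\lambda})$ in place of $(\frac1g,\dots,\frac1g)$, so that the cell is $\pi(\sigma)=\frac1\lambda(\lambda_1\sigma_1+\dots+\lambda_g\sigma_g)$. Generalized permutohedra: let $\Gamma\subset K_{m,n}$ be a bipartite graph with $m$ left and $n$ right vertices, with edges $(i,j)$ ($i$ left, $j$ right), and let $I_i=\{j:(i,j)\in\Gamma\}\subset[n]$, all nonempty. For $\lambda_1,\dots,\lambda_m>0$, the generalized permutohedron is $P_\Gamma(\lambda_1,\dots,\lambda_m)=\lambda_1\Delta_{I_1}+\dots+\lambda_m\Delta_{I_m}\subset\mathbb R^n$. In the assertion that any generalized permutohedron occurs as a cell, generalized permutohedra are considered up to overall dilation; $P_\Gamma(1,\dots,1)$ is to occur with the standard weights $\frac1g$, and $P_\Gamma(\lambda_1,\dots,\lambda_m)$ in the realization of $\mathrm{Hom}(G,H)$ with weights proportional to $(\lambda_1,\dots,\lambda_m)$.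
   Formalization: "Product of simplices" is taken to mean: for some splitting of R^h into g coordinate subspaces, the Cartesian product of g simplices, one in each, none the origin alone. In the usual sense "only if" fails: σ=({1,2},{1,2}) gives a segment. *)

theory Defs
  imports "HOL-Analysis.Analysis" "HOL-Library.Set_Algebras"
begin

section \<open>Graphs and the complex Hom(G,H)\<close>

text \<open>
  Finite undirected graphs; an edge is stored as both ordered pairs. Loops are allowed, as usual
  for Hom complexes; graphs without loops satisfy \<open>irrefl E\<close> in addition.
\<close>

definition graph :: "'v set \<Rightarrow> ('v \<times> 'v) set \<Rightarrow> bool" where
  "graph V E \<longleftrightarrow> finite V \<and> E \<subseteq> V \<times> V \<and> sym E"

text \<open>
  Throughout, \<open>V(G) = {1..g}\<close>, and \<open>V(H)\<close> is a finite type \<open>'h\<close>, so that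
  \<open>\<real>\<^sup>h\<close> is \<open>real ^ 'h\<close> and \<open>\<real>\<^sup>g\<^sup>h = (\<real>\<^sup>h)\<^sup>g\<close> is
  rendered by the extensional functions from \<open>{1..g}\<close> to \<open>real ^ 'h\<close>.
\<close>

definition std_simplex :: "'h::finite set \<Rightarrow> (real ^ 'h) set" where
  "std_simplex B = convex hull ((\<lambda>j. axis j 1) ` B)"

text \<open>A cell is recorded by its tuple of nonempty vertex sets.\<close>

definition Hom_cells ::
  "nat \<Rightarrow> (nat \<times> nat) set \<Rightarrow> ('h \<times> 'h) set \<Rightarrow> (nat \<Rightarrow> 'h set) set" where
  "Hom_cells g EG EH =
     {\<sigma> \<in> {1..g} \<rightarrow>\<^sub>E {A. A \<noteq> {}}. \<forall>(i, j) \<in> EG. \<sigma> i \<times> \<sigma> j \<subseteq> EH}"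

section \<open>Realization and projection\<close>

text \<open>For \<open>lam\<close> constantly 1 this is the standard weight vector \<open>(1/g, \<dots>, 1/g)\<close>.\<close>

definition weights :: "nat \<Rightarrow> (nat \<Rightarrow> real) \<Rightarrow> nat \<Rightarrow> real" where
  "weights g lam = (\<lambda>i\<in>{1..g}. lam i / (\<Sum>k = 1..g. lam k))"

definition realize ::
  "nat \<Rightarrow> (nat \<Rightarrow> real) \<Rightarrow> (nat \<Rightarrow> 'h::finite set) \<Rightarrow> (nat \<Rightarrow> real ^ 'h) set" where
  "realize g w \<sigma> = (\<Pi>\<^sub>E i\<in>{1..g}. (\<lambda>x. w i *\<^sub>R x) ` std_simplex (\<sigma> i))"

definition proj :: "nat \<Rightarrow> (nat \<Rightarrow> real ^ 'h::finite) \<times> (nat \<Rightarrow> real) \<Rightarrow> real ^ 'h" where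
  "proj g = (\<lambda>(x, y). \<Sum>i = 1..g. x i)"

definition proj_cell ::
  "nat \<Rightarrow> (nat \<Rightarrow> real) \<Rightarrow> (nat \<Rightarrow> 'h::finite set) \<Rightarrow> (real ^ 'h) set" where
  "proj_cell g lam \<sigma> = proj g ` (realize g (weights g lam) \<sigma> \<times> {weights g lam})"

definition proj_Hom ::
  "nat \<Rightarrow> (nat \<Rightarrow> real) \<Rightarrow> (nat \<times> nat) set \<Rightarrow> ('h::finite \<times> 'h) set \<Rightarrow> (real ^ 'h) set set"
  where
  "proj_Hom g lam EG EH = proj_cell g lam ` Hom_cells g EG EH"

section \<open>Generalized permutohedra\<close>

text \<open>
  Bipartite graphs with left vertices \<open>{1..m}\<close> and right vertices the type \<open>'n\<close>, in which
  every left vertex has a neighbour; the neighbourhood of \<open>i\<close> is \<open>\<Gamma> `` {i}\<close>.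
\<close>

definition bip_graph :: "nat \<Rightarrow> (nat \<times> 'n) set \<Rightarrow> bool" where
  "bip_graph m \<Gamma> \<longleftrightarrow> 1 \<le> m \<and> \<Gamma> \<subseteq> {1..m} \<times> UNIV \<and> (\<forall>i\<in>{1..m}. \<Gamma> `` {i} \<noteq> {})"

text \<open>The sum is the Minkowski sum of sets.\<close>

definition gen_permutohedron ::
  "nat \<Rightarrow> (nat \<times> 'n::finite) set \<Rightarrow> (nat \<Rightarrow> real) \<Rightarrow> (real ^ 'n) set" where
  "gen_permutohedron m \<Gamma> lam = (\<Sum>i = 1..m. (\<lambda>x. lam i *\<^sub>R x) ` std_simplex (\<Gamma> `` {i}))"

definition is_gen_permutohedron :: "(real ^ 'n::finite) set \<Rightarrow> bool" where
  "is_gen_permutohedron P \<longleftrightarrow>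
     (\<exists>m \<Gamma> lam. bip_graph m \<Gamma> \<and> (\<forall>i\<in>{1..m}. 0 < lam i) \<and> P = gen_permutohedron m \<Gamma> lam)"

section \<open>Products of simplices\<close>

text \<open>
  A map \<open>b\<close> assigning each coordinate to one of the indices \<open>1, \<dots>, g\<close> splits \<open>\<real>\<^sup>n\<close> as the
  product of the \<open>g\<close> coordinate subspaces \<open>coord_block b i\<close>. A polytope is a product of \<open>g\<close>
  simplices if for some such splitting it is the Cartesian product of simplices \<open>S i\<close>, one in
  each of the \<open>g\<close> factors. The factors may be points, but not the origin: otherwise a factor
  could be dropped or added at will.

  Both the position in coordinate subspaces and the number \<open>g\<close> of factors matter. For instance
  \<open>1/2 (\<Delta>{1} + \<Delta>{1})\<close> is the point \<open>e\<^sub>1\<close>, and \<open>1/2 (\<Delta>{1,2} + \<Delta>{2,3})\<close> is a parallelogram; as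
  abstract polytopes these are products of two simplices, although the summands overlap.
\<close>

definition coord_block :: "('n::finite \<Rightarrow> nat) \<Rightarrow> nat \<Rightarrow> (real ^ 'n) set" where
  "coord_block b i = {x. \<forall>j. b j \<noteq> i \<longrightarrow> x $ j = 0}"

definition block_part :: "('n::finite \<Rightarrow> nat) \<Rightarrow> nat \<Rightarrow> real ^ 'n \<Rightarrow> real ^ 'n" where
  "block_part b i x = (\<chi> j. if b j = i then x $ j else 0)"

definition is_product_of_simplices :: "nat \<Rightarrow> (real ^ 'n::finite) set \<Rightarrow> bool" where
  "is_product_of_simplices g P \<longleftrightarrow>
     (\<exists>b S. (\<forall>j. b j \<in> {1..g}) \<and>
        (\<forall>i\<in>{1..g}. S i \<subseteq> coord_block b i \<and> (\<exists>d\<ge>0. d simplex S i) \<and> S i \<noteq> {0}) \<and>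
        P = {x. \<forall>i\<in>{1..g}. block_part b i x \<in> S i})"

end

theory Submission
  imports Defs
begin

text \<open>
  If the cell is a product over blocks of coordinates, then the coordinate sum over each block is
  constant on it. The sum over a block is a linear functional, so it is constant on every summand,
  and hence each \<open>\<sigma> i\<close> lies inside a single block. No factor is the origin, so each of the \<open>g\<close>
  blocks contains one of the \<open>g\<close> sets \<open>\<sigma> i\<close>; thus different \<open>\<sigma> i\<close> lie in different blocks.
\<close>

section \<open>Standard simplices in coordinates\<close>

text \<open>The coordinate conditions cut out a convex set containing the vertices, which gives one
  inclusion; conversely, the coordinates of such a point are its barycentric coefficients.\<close>

lemma mem_std_simplex:
  fixes B :: "'h::finite set" and x :: "real ^ 'h"
  shows "x \<in> std_simplex B \<longleftrightarrow>
    (\<forall>j. 0 \<le> x $ j) \<and> (\<forall>j. j \<notin> B \<longrightarrow> x $ j = 0) \<and> (\<Sum>j\<in>UNIV. x $ j) = 1"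
proof -
  have "std_simplex B \<subseteq> {x. (\<forall>j. 0 \<le> x $ j) \<and> (\<forall>j. j \<notin> B \<longrightarrow> x $ j = 0) \<and> (\<Sum>j\<in>UNIV. x $ j) = 1}"
    unfolding std_simplex_def
  proof (rule hull_minimal)
    show "(\<lambda>j. axis j 1) ` B \<subseteq> {x. (\<forall>j. 0 \<le> x $ j) \<and> (\<forall>j. j \<notin> B \<longrightarrow> x $ j = 0) \<and> (\<Sum>j\<in>UNIV. x $ j) = (1::real)}"
      by (auto simp: axis_def)
    show "convex {x :: real ^ 'h. (\<forall>j. 0 \<le> x $ j) \<and> (\<forall>j. j \<notin> B \<longrightarrow> x $ j = 0) \<and> (\<Sum>j\<in>UNIV. x $ j) = 1}"
      unfolding convex_def by (auto simp: sum.distrib simp flip: sum_distrib_left)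
  qed
  moreover have "x \<in> std_simplex B"
    if nonneg: "\<forall>j. 0 \<le> x $ j" and zero: "\<forall>j. j \<notin> B \<longrightarrow> x $ j = 0" and one: "(\<Sum>j\<in>UNIV. x $ j) = 1"
  proof -
    have "(\<Sum>j\<in>B. x $ j) = 1"
      using one zero sum.mono_neutral_left[of UNIV B "\<lambda>j. x $ j"] by auto
    then have "(\<Sum>j\<in>B. x $ j *\<^sub>R axis j 1) \<in> std_simplex B"
      unfolding std_simplex_def
      by (intro convex_sum) (auto simp: nonneg intro: hull_inc)
    also have "(\<Sum>j\<in>B. x $ j *\<^sub>R axis j 1) = x"
      using zero by (auto simp: vec_eq_iff axis_def if_distrib cong: if_cong)
    finally show ?thesis .
  qed
  ultimately show ?thesis
    by blast
qed

lemma axis_mem_std_simplex: "j \<in> B \<Longrightarrow> axis j 1 \<in> std_simplex B"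
  unfolding std_simplex_def by (simp add: hull_inc)

text \<open>Scaling by \<open>c \<noteq> 0\<close> is linear and injective, so the scaled basis
  vectors stay independent and hence affinely independent.\<close>

lemma simplex_scaled_std_simplex:
  fixes B :: "'h::finite set"
  assumes "c \<noteq> 0"
  shows "(int (card B) - 1) simplex ((\<lambda>x. c *\<^sub>R x) ` std_simplex B)"
proof -
  have inj: "inj_on (\<lambda>x :: real ^ 'h. c *\<^sub>R x) A" for A
    using assms by (simp add: inj_on_def)
  have "independent ((\<lambda>j. axis j 1 :: real ^ 'h) ` B)"
    by (rule independent_mono[OF independent_Basis]) auto
  then have "\<not> affine_dependent ((\<lambda>x. c *\<^sub>R x) ` (\<lambda>j. axis j 1 :: real ^ 'h) ` B)"
    using linear_independent_injective_image[OF linear_scaleR _ inj] affine_dependent_imp_dependent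
    by blast
  moreover have "card ((\<lambda>x. c *\<^sub>R x) ` (\<lambda>j. axis j 1 :: real ^ 'h) ` B) = card B"
    by (subst card_image[OF inj]) (simp add: card_image inj_on_def axis_eq_axis)
  ultimately show ?thesis
    unfolding simplex std_simplex_def
    by (intro exI[of _ "(\<lambda>x. c *\<^sub>R x) ` (\<lambda>j. axis j 1) ` B"]) (auto simp: convex_hull_scaling)
qed

section \<open>Cells and permutohedra as sets of weighted sums\<close>

text \<open>Trades the extensional tuples of \<open>realize\<close> for arbitrary functions
  \<open>s\<close>, so that a point of each simplex can be chosen freely and the weights stay
  explicit.\<close>

lemma proj_cell_eq:
  "proj_cell g lam \<sigma> =
     {\<Sum>i = 1..g. weights g lam i *\<^sub>R s i |s. \<forall>i\<in>{1..g}. s i \<in> std_simplex (\<sigma> i)}"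
    (is "_ = ?R")
proof
  show "proj_cell g lam \<sigma> \<subseteq> ?R"
  proof
    fix p assume "p \<in> proj_cell g lam \<sigma>"
    then obtain x where p: "p = (\<Sum>i = 1..g. x i)"
      and "\<forall>i\<in>{1..g}. \<exists>s. s \<in> std_simplex (\<sigma> i) \<and> x i = weights g lam i *\<^sub>R s"
      unfolding proj_cell_def realize_def proj_def by (auto simp: PiE_iff image_iff Bex_def)
    then obtain s where "\<forall>i\<in>{1..g}. s i \<in> std_simplex (\<sigma> i) \<and> x i = weights g lam i *\<^sub>R s i"
      by metis
    then show "p \<in> ?R"
      unfolding p by (auto intro!: exI[of _ s] sum.cong)
  qed
next
  show "?R \<subseteq> proj_cell g lam \<sigma>"
  proof clarify
    fix s assume "\<forall>i\<in>{1..g}. s i \<in> std_simplex (\<sigma> i)"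
    \<comment> \<open>Restricting to \<open>{1..g}\<close> makes the tuple extensional, as
      membership in \<open>realize\<close> demands.\<close>
    then have mem: "(\<lambda>i\<in>{1..g}. weights g lam i *\<^sub>R s i) \<in> realize g (weights g lam) \<sigma>"
      unfolding realize_def by auto
    have val: "proj g (\<lambda>i\<in>{1..g}. weights g lam i *\<^sub>R s i, weights g lam) =
        (\<Sum>i = 1..g. weights g lam i *\<^sub>R s i)"
      unfolding proj_def by simp
    show "(\<Sum>i = 1..g. weights g lam i *\<^sub>R s i) \<in> proj_cell g lam \<sigma>"
      unfolding proj_cell_def val[symmetric]
      by (rule imageI[where f = "proj g"]) (intro SigmaI mem singletonI)
  qed
qed

text \<open>The same normal form as for projected cells, so that comparing the two reduces to
  comparing index sets and coefficients.\<close>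

lemma gen_permutohedron_eq:
  "gen_permutohedron m \<Gamma> lam =
     {\<Sum>i = 1..m. lam i *\<^sub>R s i |s. \<forall>i\<in>{1..m}. s i \<in> std_simplex (\<Gamma> `` {i})}"
    (is "_ = ?R")
proof -
  have "gen_permutohedron m \<Gamma> lam =
      {\<Sum>i = 1..m. x i |x. \<forall>i\<in>{1..m}. x i \<in> (\<lambda>x. lam i *\<^sub>R x) ` std_simplex (\<Gamma> `` {i})}"
    unfolding gen_permutohedron_def by (rule set_sum_alt) simp
  also have "\<dots> = ?R"
  proof (intro subset_antisym subsetI)
    fix p assume "p \<in> {\<Sum>i = 1..m. x i |x. \<forall>i\<in>{1..m}. x i \<in> (\<lambda>x. lam i *\<^sub>R x) ` std_simplex (\<Gamma> `` {i})}"
    then obtain x where p: "p = (\<Sum>i = 1..m. x i)"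
      and "\<forall>i\<in>{1..m}. \<exists>s. s \<in> std_simplex (\<Gamma> `` {i}) \<and> x i = lam i *\<^sub>R s"
      by (auto simp: image_iff Bex_def)
    then obtain s where "\<forall>i\<in>{1..m}. s i \<in> std_simplex (\<Gamma> `` {i}) \<and> x i = lam i *\<^sub>R s i"
      by metis
    then show "p \<in> ?R"
      unfolding p by (auto intro!: exI[of _ s] sum.cong)
  qed blast
  finally show ?thesis .
qed

lemma weights_pos:
  assumes "\<forall>i\<in>{1..g}. 0 < lam i" "i \<in> {1..g}"
  shows "0 < weights g lam i"
  using assms unfolding weights_def by (auto intro!: divide_pos_pos sum_pos)

lemma sum_weights:
  assumes "1 \<le> g" "\<forall>i\<in>{1..g}. 0 < lam i"
  shows "(\<Sum>i = 1..g. weights g lam i) = 1"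
proof -
  have "0 < (\<Sum>k = 1..g. lam k)"
    using assms by (intro sum_pos) auto
  then show ?thesis
    unfolding weights_def by (simp flip: sum_divide_distrib)
qed

section \<open>Cells versus generalized permutohedra\<close>

lemma is_gen_permutohedron_proj_cell:
  assumes "1 \<le> g" "\<forall>i\<in>{1..g}. 0 < lam i" "\<sigma> \<in> Hom_cells g EG EH"
  shows "is_gen_permutohedron (proj_cell g lam \<sigma>)"
proof -
  \<comment> \<open>The left vertex \<open>i\<close> is joined to the elements of
    \<open>\<sigma> i\<close>; the normalized weights serve as dilation factors.\<close>
  define \<Gamma> where "\<Gamma> = Sigma {1..g} \<sigma>"
  have nbh: "\<Gamma> `` {i} = \<sigma> i" if "i \<in> {1..g}" for i
    using that unfolding \<Gamma>_def by auto
  have "\<sigma> i \<noteq> {}" if "i \<in> {1..g}" for i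
    using assms(3) that unfolding Hom_cells_def by auto
  then have "bip_graph g \<Gamma>"
    using assms(1) nbh unfolding bip_graph_def by (auto simp: \<Gamma>_def)
  moreover have "proj_cell g lam \<sigma> = gen_permutohedron g \<Gamma> (weights g lam)"
    proof -
    have "(\<forall>i\<in>{1..g}. s i \<in> std_simplex (\<Gamma> `` {i})) \<longleftrightarrow> (\<forall>i\<in>{1..g}. s i \<in> std_simplex (\<sigma> i))" for s
      using nbh by metis
    then show ?thesis
      unfolding proj_cell_eq gen_permutohedron_eq by simp
  qed
  ultimately show ?thesis
    unfolding is_gen_permutohedron_def using weights_pos[OF assms(2)] by blast
qed

text \<open>Without edges in G the edge condition is vacuous, so the tuple of nonempty
  neighbourhoods is a cell; dividing by the sum of \<open>lam\<close> turns the coefficients into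
  \<open>weights\<close>.\<close>

lemma scaled_gen_permutohedron_mem_proj_Hom:
  fixes \<Gamma> :: "(nat \<times> 'n::finite) set"
  assumes "bip_graph m \<Gamma>"
  shows "(\<lambda>x. (1 / (\<Sum>k = 1..m. lam k)) *\<^sub>R x) ` gen_permutohedron m \<Gamma> lam \<in> proj_Hom m lam {} {}"
proof -
  let ?c = "1 / (\<Sum>k = 1..m. lam k)"
  define \<sigma> where "\<sigma> = (\<lambda>i\<in>{1..m}. \<Gamma> `` {i})"
  have "\<sigma> \<in> Hom_cells m {} {}"
    using assms unfolding Hom_cells_def bip_graph_def \<sigma>_def by auto
  have scale: "?c *\<^sub>R (\<Sum>i = 1..m. lam i *\<^sub>R s i) = (\<Sum>i = 1..m. weights m lam i *\<^sub>R s i)"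
    for s :: "nat \<Rightarrow> real ^ 'n"
    unfolding scaleR_sum_right weights_def by (intro sum.cong) auto
  have "(\<forall>i\<in>{1..m}. s i \<in> std_simplex (\<sigma> i)) \<longleftrightarrow> (\<forall>i\<in>{1..m}. s i \<in> std_simplex (\<Gamma> `` {i}))" for s
    unfolding \<sigma>_def by simp
  then have "(\<lambda>x. ?c *\<^sub>R x) ` gen_permutohedron m \<Gamma> lam = proj_cell m lam \<sigma>"
    unfolding proj_cell_eq gen_permutohedron_eq setcompr_eq_image image_image scale by simp
  then show ?thesis
    unfolding proj_Hom_def using \<open>\<sigma> \<in> Hom_cells m {} {}\<close> by blast
qed

section \<open>Disjoint summands give a product\<close>

text \<open>Summands with disjoint supports occupy different coordinates, so their Minkowski sum is
  a Cartesian product; the factors are the scaled simplices.\<close>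

lemma is_product_of_simplices_if_disjoint:
  fixes \<sigma> :: "nat \<Rightarrow> 'h::finite set"
  assumes "1 \<le> g" and lam: "\<forall>i\<in>{1..g}. 0 < lam i"
    and ne: "\<And>i. i \<in> {1..g} \<Longrightarrow> \<sigma> i \<noteq> {}"
    and disj: "\<forall>i\<in>{1..g}. \<forall>j\<in>{1..g}. i \<noteq> j \<longrightarrow> \<sigma> i \<inter> \<sigma> j = {}"
  shows "is_product_of_simplices g (proj_cell g lam \<sigma>)"
proof -
  define w where "w = weights g lam"
  have w: "0 < w i" if "i \<in> {1..g}" for i
    unfolding w_def using lam that by (rule weights_pos)
  \<comment> \<open>Disjointness makes the index of a coordinate in some \<open>\<sigma> i\<close>
    unique; a coordinate in none of them goes to an arbitrary index, which exists as
    \<open>1 \<le> g\<close>.\<close>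
  have "\<exists>k. k \<in> {1..g} \<and> (\<forall>i\<in>{1..g}. j \<in> \<sigma> i \<longrightarrow> k = i)" for j
    using disj \<open>1 \<le> g\<close> by (metis IntI atLeastAtMost_iff empty_iff order_refl)
  then obtain b where b_range: "\<forall>j. b j \<in> {1..g}"
    and b: "\<And>i j. i \<in> {1..g} \<Longrightarrow> j \<in> \<sigma> i \<Longrightarrow> b j = i"
    by metis
  define S where "S i = (\<lambda>x. w i *\<^sub>R x) ` std_simplex (\<sigma> i)" for i
  have sub: "S i \<subseteq> coord_block b i" if "i \<in> {1..g}" for i
    using b[OF that] unfolding S_def coord_block_def by (force simp: mem_std_simplex)
  have splx: "\<exists>d\<ge>0. d simplex S i" if "i \<in> {1..g}" for i
  proof (intro exI conjI)
    show "(int (card (\<sigma> i)) - 1) simplex S i"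
      unfolding S_def using w[OF that] by (intro simplex_scaled_std_simplex) simp
    \<comment> \<open>Nonemptiness excludes dimension -1, the empty simplex.\<close>
    have "0 < card (\<sigma> i)"
      using ne[OF that] by (simp add: card_gt_0_iff)
    then show "0 \<le> int (card (\<sigma> i)) - 1"
      by simp
  qed
  have nz: "S i \<noteq> {0}" if i: "i \<in> {1..g}" for i
  proof -
    obtain j where "j \<in> \<sigma> i"
      using ne[OF i] by auto
    then have "w i *\<^sub>R axis j 1 \<in> S i"
      unfolding S_def by (intro imageI axis_mem_std_simplex)
    moreover have "w i *\<^sub>R axis j (1::real) \<noteq> 0"
      using w[OF i] by (simp add: axis_eq_0_iff)
    ultimately show ?thesis
      by (metis singletonD)
  qed
  have "proj_cell g lam \<sigma> = {x. \<forall>i\<in>{1..g}. block_part b i x \<in> S i}"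
  proof (intro set_eqI iffI)
    fix x assume "x \<in> proj_cell g lam \<sigma>"
    then obtain s where x: "x = (\<Sum>i = 1..g. w i *\<^sub>R s i)"
      and s: "\<forall>i\<in>{1..g}. s i \<in> std_simplex (\<sigma> i)"
      unfolding proj_cell_eq w_def mem_Collect_eq by (elim exE conjE)
    have "block_part b i x = w i *\<^sub>R s i" if i: "i \<in> {1..g}" for i
    proof -
      have off: "s k $ j = 0" if "k \<in> {1..g}" "b j \<noteq> k" for j k
        using that s b by (meson mem_std_simplex)
      \<comment> \<open>At coordinate \<open>j\<close> only the summand with index
        \<open>b j\<close> can be nonzero.\<close>
      have "x $ j = (\<Sum>k\<in>{1..g}. if k = b j then w k * s k $ j else 0)" for j
        unfolding x sum_component by (intro sum.cong refl) (auto simp: off)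
      then have "x $ j = w (b j) * s (b j) $ j" for j
        using b_range by simp
      then show ?thesis
        using off[OF i] by (auto simp: block_part_def vec_eq_iff)
    qed
    then show "x \<in> {x. \<forall>i\<in>{1..g}. block_part b i x \<in> S i}"
      using s unfolding S_def by auto
  next
    fix x assume "x \<in> {x. \<forall>i\<in>{1..g}. block_part b i x \<in> S i}"
    then have "\<forall>i\<in>{1..g}. \<exists>s. s \<in> std_simplex (\<sigma> i) \<and> block_part b i x = w i *\<^sub>R s"
      unfolding S_def by auto
    then obtain s where s: "\<forall>i\<in>{1..g}. s i \<in> std_simplex (\<sigma> i) \<and> block_part b i x = w i *\<^sub>R s i"
      by metis
    \<comment> \<open>Every coordinate belongs to exactly one block.\<close>
    have "x = (\<Sum>i = 1..g. block_part b i x)"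
      using b_range by (auto simp: vec_eq_iff block_part_def)
    also have "\<dots> = (\<Sum>i = 1..g. w i *\<^sub>R s i)"
      using s by (intro sum.cong) auto
    finally show "x \<in> proj_cell g lam \<sigma>"
      unfolding proj_cell_eq w_def[symmetric] mem_Collect_eq using s by (intro exI[of _ s]) simp
  qed
  with b_range sub splx nz show ?thesis
    unfolding is_product_of_simplices_def by (intro exI[of _ b] exI[of _ S]) simp
qed

section \<open>A product structure forces disjoint summands\<close>

text \<open>The new point has block \<open>k\<close> from \<open>x\<close> and all other blocks from
  \<open>y\<close>; a product admits such exchanges because membership is tested block by
  block.\<close>

lemma block_part_convolution:
  assumes "P = {x. \<forall>i\<in>I. block_part b i x \<in> S i}" and "x \<in> P" "y \<in> P"
  shows "y + block_part b k (x - y) \<in> P"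
proof -
  have "block_part b i (y + block_part b k (x - y)) =
      (if i = k then block_part b i x else block_part b i y)" for i
    by (auto simp: block_part_def vec_eq_iff)
  then show ?thesis
    using assms by auto
qed

lemma disjoint_if_is_product_of_simplices:
  fixes \<sigma> :: "nat \<Rightarrow> 'h::finite set"
  assumes "1 \<le> g" and lam: "\<forall>i\<in>{1..g}. 0 < lam i"
    and ne: "\<And>i. i \<in> {1..g} \<Longrightarrow> \<sigma> i \<noteq> {}"
    and prod: "is_product_of_simplices g (proj_cell g lam \<sigma>)"
  shows "\<forall>i\<in>{1..g}. \<forall>j\<in>{1..g}. i \<noteq> j \<longrightarrow> \<sigma> i \<inter> \<sigma> j = {}"
proof -
  define w where "w = weights g lam"
  have w: "0 < w i" if "i \<in> {1..g}" for i
    unfolding w_def using lam that by (rule weights_pos)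
  have w_sum: "(\<Sum>i = 1..g. w i) = 1"
    unfolding w_def using \<open>1 \<le> g\<close> lam by (rule sum_weights)
  define P where "P = proj_cell g lam \<sigma>"
  have P: "P = {\<Sum>i = 1..g. w i *\<^sub>R s i |s. \<forall>i\<in>{1..g}. s i \<in> std_simplex (\<sigma> i)}"
    unfolding P_def w_def by (rule proj_cell_eq)
  obtain b S where b: "\<forall>j. b j \<in> {1..g}"
    and sub: "\<And>i. i \<in> {1..g} \<Longrightarrow> S i \<subseteq> coord_block b i"
    and splx: "\<And>i. i \<in> {1..g} \<Longrightarrow> \<exists>d\<ge>0. d simplex S i"
    and nz: "\<And>i. i \<in> {1..g} \<Longrightarrow> S i \<noteq> {0}"
    and P_eq: "P = {x. \<forall>i\<in>{1..g}. block_part b i x \<in> S i}"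
    using prod unfolding is_product_of_simplices_def P_def[symmetric] by blast
  \<comment> \<open>Each summand has coordinate sum 1 and the weights add up to 1. The exchange of
    blocks is tested against this invariant.\<close>
  have total: "(\<Sum>j\<in>UNIV. x $ j) = 1" if "x \<in> P" for x
  proof -
    obtain s where x: "x = (\<Sum>i = 1..g. w i *\<^sub>R s i)"
      and s: "\<forall>i\<in>{1..g}. s i \<in> std_simplex (\<sigma> i)"
      using \<open>x \<in> P\<close> unfolding P mem_Collect_eq by (elim exE conjE)
    have "(\<Sum>j\<in>UNIV. x $ j) = (\<Sum>i = 1..g. w i * (\<Sum>j\<in>UNIV. s i $ j))"
      unfolding x by (simp add: sum_distrib_left) (rule sum.swap)
    also have "\<dots> = (\<Sum>i = 1..g. w i)"
      using s by (intro sum.cong) (auto simp: mem_std_simplex)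
    finally show ?thesis
      using w_sum by simp
  qed
  \<comment> \<open>Replacing block \<open>k\<close> of \<open>y\<close> by that of \<open>x\<close>
    stays in \<open>P\<close>, where the total is 1; so the two blocks have the same sum.\<close>
  have block_sum: "(\<Sum>j | b j = k. x $ j) = (\<Sum>j | b j = k. y $ j)" if "x \<in> P" "y \<in> P" for x y k
  proof -
    have "(\<Sum>j\<in>UNIV. (y + block_part b k (x - y)) $ j) = 1"
      using block_part_convolution[OF P_eq that] by (rule total)
    then have "(\<Sum>j\<in>UNIV. y $ j) + (\<Sum>j\<in>UNIV. if b j = k then (x - y) $ j else 0) = 1"
      by (simp add: block_part_def sum.distrib)
    then show ?thesis
      using total[OF that(2)] by (simp add: sum.If_cases sum_subtractf)
  qed
  have vertex: "(\<Sum>i = 1..g. w i *\<^sub>R axis (v i) 1) \<in> P" if "\<forall>i\<in>{1..g}. v i \<in> \<sigma> i" for v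
    unfolding P using that
    by (intro CollectI exI[of _ "\<lambda>i. axis (v i) 1"]) (simp add: axis_mem_std_simplex)
  \<comment> \<open>A unit vector contributes its weight to the block of its coordinate and nothing
    to any other.\<close>
  have vertex_sum: "(\<Sum>j | b j = k. (\<Sum>i = 1..g. w i *\<^sub>R axis (v i) 1) $ j) =
      (\<Sum>i = 1..g. if b (v i) = k then w i else 0)" for v :: "nat \<Rightarrow> 'h" and k
  proof -
    have "(\<Sum>j | b j = k. (\<Sum>i = 1..g. w i *\<^sub>R axis (v i) 1) $ j) =
        (\<Sum>i = 1..g. \<Sum>j | b j = k. w i * axis (v i) 1 $ j)"
      by (simp only: sum_component vector_scaleR_component real_scaleR_def sum.swap[of _ "{j. b j = k}"])
    also have "\<dots> = (\<Sum>i = 1..g. if b (v i) = k then w i else 0)"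
      by (intro sum.cong refl) (auto simp: axis_def if_distrib sum.delta cong: if_cong)
    finally show ?thesis .
  qed
  \<comment> \<open>Representatives: once each \<open>\<sigma> i\<close> is known to lie in one
    block, \<open>b (v i)\<close> names that block.\<close>
  obtain v where v: "\<forall>i\<in>{1..g}. v i \<in> \<sigma> i"
    using ne bchoice[of "{1..g}" "\<lambda>i j. j \<in> \<sigma> i"] by blast
  \<comment> \<open>Replacing only \<open>v i\<close> by \<open>u\<close> would raise the sum over
    block \<open>b u\<close> by the positive \<open>w i\<close>, although block sums are constant on
    \<open>P\<close>.\<close>
  have one_block: "b u = b (v i)" if i: "i \<in> {1..g}" and u: "u \<in> \<sigma> i" for i u
  proof (rule ccontr)
    assume neq: "b u \<noteq> b (v i)"
    have "\<forall>k\<in>{1..g}. (v(i := u)) k \<in> \<sigma> k"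
      using v u by auto
    from block_sum[OF vertex[OF this] vertex[OF v], of "b u"]
    have "(\<Sum>k = 1..g. if b ((v(i := u)) k) = b u then w k else 0) =
        (\<Sum>k = 1..g. if b (v k) = b u then w k else 0)"
      unfolding vertex_sum .
    moreover have "(\<Sum>k\<in>{1..g} - {i}. if b ((v(i := u)) k) = b u then w k else 0) =
        (\<Sum>k\<in>{1..g} - {i}. if b (v k) = b u then w k else 0)"
      by (intro sum.cong) auto
    ultimately show False
      using w[OF i] neq unfolding sum.remove[OF finite_atLeastAtMost i] by simp
  qed
  \<comment> \<open>If no \<open>\<sigma> i\<close> met block \<open>k\<close>, all of
    \<open>P\<close> would vanish there, which would force the factor \<open>S k\<close> to be the
    origin.\<close>
  have "k \<in> (\<lambda>i. b (v i)) ` {1..g}" if k: "k \<in> {1..g}" for k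
  proof (rule ccontr)
    assume notin: "k \<notin> (\<lambda>i. b (v i)) ` {1..g}"
    have block_zero: "x $ j = 0" if "x \<in> P" "b j = k" for x j
    proof -
      obtain s where x: "x = (\<Sum>i = 1..g. w i *\<^sub>R s i)"
        and s: "\<forall>i\<in>{1..g}. s i \<in> std_simplex (\<sigma> i)"
        using \<open>x \<in> P\<close> unfolding P mem_Collect_eq by (elim exE conjE)
      have "s i $ j = 0" if "i \<in> {1..g}" for i
        using that s one_block notin \<open>b j = k\<close> by (metis image_eqI mem_std_simplex)
      then show ?thesis
        unfolding x by simp
    qed
    have "x = 0" if "x \<in> S k" for x
    proof -
      obtain p where p: "p \<in> P"
        using vertex[OF v] by blast
      \<comment> \<open>\<open>q\<close> is \<open>p\<close> with block \<open>k\<close> replaced by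
        the given \<open>x\<close>: every element of a factor is a block of some point of
        \<open>P\<close>.\<close>
      define q where "q = p - block_part b k p + x"
      have off: "x $ j = 0" if "b j \<noteq> k" for j
        using sub[OF k] \<open>x \<in> S k\<close> that by (auto simp: coord_block_def)
      then have q_part: "block_part b i q = (if i = k then x else block_part b i p)" for i
        by (auto simp: q_def block_part_def vec_eq_iff)
      then have "q \<in> P"
        using p that unfolding P_eq by auto
      then have "block_part b k q = 0"
        using block_zero by (simp add: block_part_def vec_eq_iff)
      then show ?thesis
        using q_part by simp
    qed
    \<comment> \<open>A simplex of dimension \<open>d \<ge> 0\<close> has a vertex.\<close>
    moreover have "S k \<noteq> {}"
      using splx[OF k] by auto
    ultimately show False
      using nz[OF k] by blast
  qed
  then have "(\<lambda>i. b (v i)) ` {1..g} = {1..g}"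
    using b by auto
  \<comment> \<open>A surjection of a finite set onto itself is injective, so distinct indices have
    distinct blocks; an element shared by two of the sets would, by \<open>one_block\<close>, give
    their indices the same block.\<close>
  then have "inj_on (\<lambda>i. b (v i)) {1..g}"
    by (intro eq_card_imp_inj_on) auto
  then show ?thesis
    using one_block by (metis disjoint_iff inj_onD)
qed

theorem theorem2p11:
  shows
    "(\<forall>(g::nat) EG (EH :: ('h::finite \<times> 'h) set) (lam :: nat \<Rightarrow> real).
        1 \<le> g \<longrightarrow> graph {1..g} EG \<longrightarrow> graph UNIV EH \<longrightarrow> (\<forall>i\<in>{1..g}. 0 < lam i) \<longrightarrow>
        (\<forall>P \<in> proj_Hom g lam EG EH. is_gen_permutohedron P)) \<and>
     (\<forall>(m::nat) (\<Gamma> :: (nat \<times> 'n::finite) set) (lam :: nat \<Rightarrow> real).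
        bip_graph m \<Gamma> \<longrightarrow> (\<forall>i\<in>{1..m}. 0 < lam i) \<longrightarrow>
        (\<exists>EG (EH :: ('n \<times> 'n) set) c.
           graph {1..m} EG \<and> irrefl EG \<and> graph UNIV EH \<and> irrefl EH \<and> 0 < c \<and>
           (\<lambda>x. c *\<^sub>R x) ` gen_permutohedron m \<Gamma> lam \<in> proj_Hom m lam EG EH)) \<and>
     (\<forall>(g::nat) EG (EH :: ('h::finite \<times> 'h) set) (lam :: nat \<Rightarrow> real) \<sigma>.
        1 \<le> g \<longrightarrow> graph {1..g} EG \<longrightarrow> graph UNIV EH \<longrightarrow> (\<forall>i\<in>{1..g}. 0 < lam i) \<longrightarrow>
        \<sigma> \<in> Hom_cells g EG EH \<longrightarrow>
        (is_product_of_simplices g (proj_cell g lam \<sigma>) \<longleftrightarrow>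
         (\<forall>i\<in>{1..g}. \<forall>j\<in>{1..g}. i \<noteq> j \<longrightarrow> \<sigma> i \<inter> \<sigma> j = {})))"
proof (intro conjI allI impI ballI)
  fix g EG and EH :: "('h \<times> 'h) set" and lam P
  assume "1 \<le> g" "\<forall>i\<in>{1..g}. 0 < lam i" "P \<in> proj_Hom g lam EG EH"
  then show "is_gen_permutohedron P"
    unfolding proj_Hom_def by (auto intro: is_gen_permutohedron_proj_cell)
next
  fix m and \<Gamma> :: "(nat \<times> 'n) set" and lam :: "nat \<Rightarrow> real"
  assume bip: "bip_graph m \<Gamma>" and "\<forall>i\<in>{1..m}. 0 < lam i"
  \<comment> \<open>\<open>1 \<le> m\<close> in \<open>bip_graph\<close> makes the sum nonempty,
    hence positive.\<close>
  then have "0 < 1 / (\<Sum>k = 1..m. lam k)"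
    unfolding bip_graph_def by (auto intro!: divide_pos_pos sum_pos)
  moreover have "graph {1..m} {}" "graph (UNIV :: 'n set) {}"
    by (auto simp: graph_def sym_def)
  \<comment> \<open>Both edge sets are empty, and \<open>c\<close> is the reciprocal of the sum of
    \<open>lam\<close>.\<close>
  ultimately show "\<exists>EG (EH :: ('n \<times> 'n) set) c.
      graph {1..m} EG \<and> irrefl EG \<and> graph UNIV EH \<and> irrefl EH \<and> 0 < c \<and>
      (\<lambda>x. c *\<^sub>R x) ` gen_permutohedron m \<Gamma> lam \<in> proj_Hom m lam EG EH"
    using scaled_gen_permutohedron_mem_proj_Hom[OF bip, of lam]
    by (intro exI conjI) (assumption | simp add: irrefl_def)+
next
  fix g EG and EH :: "('h \<times> 'h) set" and lam :: "nat \<Rightarrow> real" and \<sigma>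
  assume g: "1 \<le> g" and lam: "\<forall>i\<in>{1..g}. 0 < lam i" and "\<sigma> \<in> Hom_cells g EG EH"
  then have "\<sigma> i \<noteq> {}" if "i \<in> {1..g}" for i
    using that unfolding Hom_cells_def by auto
  then show "is_product_of_simplices g (proj_cell g lam \<sigma>) \<longleftrightarrow>
      (\<forall>i\<in>{1..g}. \<forall>j\<in>{1..g}. i \<noteq> j \<longrightarrow> \<sigma> i \<inter> \<sigma> j = {})"
    using is_product_of_simplices_if_disjoint[OF g lam] disjoint_if_is_product_of_simplices[OF g lam]
    by blast
qed

end
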